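(* Let $m\ge2$ and let $\mathbf b=(b_n)_{n\ge0}$ be complex numbers with $b_0\neq0$, $b_0+b_1+\cdots=1$, $\sum_{j\ge1}jb_j$ convergent and $m\neq\sum_{j=1}^\infty jb_j$. Let $B(s)=\sum_n b_ns^n$ and let $\lambda_1,\ldots,\lambda_{m-1}$ be simple roots of $B(s)-s^m$, all different from $1$. Let $\mathbf a=(a_n)_{n\ge0}$ satisfy $a_n=\sum_{j=0}^{n+m}b_{n+m-j}a_j$ for all $n\in\mathbb{N}_0$, and suppose $a_0,\ldots,a_{m-1}$ are such that the finite limit $\lim_{n\to\infty}a_n$ exists. Define $$L_j:=\lim_{s\to\lambda_j}\frac{B(s)-s^m}{1-s}\sum_{k=0}^{m-1}a_kM_k(s),\quad j=1,\ldots,m-1,\qquad L:=\Big(m-\sum_{j=1}^\infty jb_j\Big)\lim_{n\to\infty}a_n.$$ Then $$\sum_{k=0}^{m-1}\Big(\sum_{n=k}^{m-1}b_{n-k}\lambda_j^n\Big)a_k=L_j\ (j=1,\ldots,m-1),\qquad \sum_{k=0}^{m-1}\Big(\sum_{n=k}^{m-1}b_{n-k}\Big)a_k=L,$$ and this linear system in the unknowns $a_0,\ldots,a_{m-1}$ has a unique solution, namely $(a_0,\ldots,a_{m-1})$.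
   Context: For $k\in\{0,\ldots,m-1\}$, $(\alpha_k(n))_{n\ge0}$ is defined by $\alpha_k(j)=1$ if $j=k$, $\alpha_k(j)=0$ if $j\in\{0,\ldots,m-1\}\setminus\{k\}$, and for $n\ge m$ by $\alpha_k(n)=\frac{1}{b_0}\big(\alpha_k(n-m)-\sum_{j=0}^{n-1}b_{n-j}\alpha_k(j)\big)$; $G\alpha_k(s)=\sum_n\alpha_k(n)s^n$, which as a function equals $\sum_{n=k}^{m-1}b_{n-k}s^n/(B(s)-s^m)$. $M_k(s)$ denotes the Maclaurin series of $(1-s)G\alpha_k(s)$ (understood as the function $(1-s)G\alpha_k(s)$ when taking the limits defining $L_j$). Roots $\lambda_j$ are points in the disk of convergence of $B$. *)

theory Defs
  imports "HOL-Complex_Analysis.Complex_Analysis"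
begin

definition gf :: "(nat \<Rightarrow> complex) \<Rightarrow> complex \<Rightarrow> complex" where
  "gf b s = (\<Sum>n. b n * s ^ n)"

definition simple_root :: "(complex \<Rightarrow> complex) \<Rightarrow> complex \<Rightarrow> bool" where
  "simple_root f z \<longleftrightarrow> f z = 0 \<and> deriv f z \<noteq> 0"

fun alpha :: "nat \<Rightarrow> (nat \<Rightarrow> complex) \<Rightarrow> nat \<Rightarrow> nat \<Rightarrow> complex" where
  "alpha m b k n =
     (if n < m then (if n = k then 1 else 0)
      else if m = 0 then 0 \<comment> \<open>only to make the recursion terminate; \<open>m \<ge> 2\<close> in all uses\<close>
      else (alpha m b k (n - m) - (\<Sum>j<n. b (n - j) * alpha m b k j)) / b 0)"

declare alpha.simps [simp del]

text \<open>
  The power series with coefficients \<open>alpha m b k\<close> need not converge near the roots of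
  \<open>gf b s - s ^ m\<close>, so its sum is continued meromorphically to the disk of convergence
  of \<open>gf b\<close>.  The lemma \<open>quotient_continues_alpha\<close> below shows that a continuation exists.
  By the identity theorem it is unique up to its values at isolated points, which do not
  matter for limits.
\<close>

definition continues_alpha ::
  "nat \<Rightarrow> (nat \<Rightarrow> complex) \<Rightarrow> nat \<Rightarrow> (complex \<Rightarrow> complex) \<Rightarrow> bool" where
  "continues_alpha m b k g \<longleftrightarrow>
     g meromorphic_on eball 0 (conv_radius b) \<and>
     g has_fps_expansion Abs_fps (alpha m b k)"

definition G_alpha :: "nat \<Rightarrow> (nat \<Rightarrow> complex) \<Rightarrow> nat \<Rightarrow> complex \<Rightarrow> complex" where
  "G_alpha m b k = (SOME g. continues_alpha m b k g)"

definition M :: "nat \<Rightarrow> (nat \<Rightarrow> complex) \<Rightarrow> nat \<Rightarrow> complex \<Rightarrow> complex" where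
  "M m b k s = (1 - s) * G_alpha m b k s"

definition root_fun :: "nat \<Rightarrow> (nat \<Rightarrow> complex) \<Rightarrow> (nat \<Rightarrow> complex) \<Rightarrow> complex \<Rightarrow> complex" where
  "root_fun m b a s = (gf b s - s ^ m) / (1 - s) * (\<Sum>k<m. a k * M m b k s)"

definition root_limit :: "nat \<Rightarrow> (nat \<Rightarrow> complex) \<Rightarrow> (nat \<Rightarrow> complex) \<Rightarrow> complex \<Rightarrow> complex" where
  "root_limit m b a z = Lim (at z) (root_fun m b a)"

definition one_limit :: "nat \<Rightarrow> (nat \<Rightarrow> complex) \<Rightarrow> (nat \<Rightarrow> complex) \<Rightarrow> complex" where
  "one_limit m b a = (of_nat m - (\<Sum>j. of_nat j * b j)) * lim a"

lemma gf_eq_eval_fps: "gf b = eval_fps (Abs_fps b)"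
  by (rule ext) (simp add: gf_def eval_fps_def)

lemma alpha_fps_identity:
  assumes "k < m" "b 0 \<noteq> 0"
  shows "(Abs_fps b - fps_X ^ m) * Abs_fps (alpha m b k) =
         (\<Sum>n=k..<m. fps_const (b (n - k)) * fps_X ^ n)" (is "?l = ?r")
proof (rule fps_ext)
  fix n
  have r: "?r $ n = (if k \<le> n \<and> n < m then b (n - k) else 0)"
    by (auto simp: fps_sum_nth if_distrib cong: if_cong)
  have "(Abs_fps b * Abs_fps (alpha m b k)) $ n = (\<Sum>j\<le>n. b (n - j) * alpha m b k j)"
    by (subst mult.commute, subst fps_mult_nth) (simp add: atLeast0AtMost mult.commute[of "b _"])
  moreover have "(fps_X ^ m * Abs_fps (alpha m b k)) $ n =
      (if n < m then 0 else alpha m b k (n - m))"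
    by (simp add: fps_X_power_mult_nth)
  ultimately have l: "?l $ n = (\<Sum>j\<le>n. b (n - j) * alpha m b k j) -
      (if n < m then 0 else alpha m b k (n - m))"
    by (simp add: left_diff_distrib)
  show "?l $ n = ?r $ n"
  proof (cases "n < m")
    case True
    have "(\<Sum>j\<le>n. b (n - j) * alpha m b k j) = (\<Sum>j\<le>n. if j = k then b (n - k) else 0)"
      using True by (intro sum.cong) (auto simp: alpha.simps[of m b k])
    then show ?thesis using True unfolding l r by simp
  next
    case False
    have "alpha m b k n = (alpha m b k (n - m) - (\<Sum>j<n. b (n - j) * alpha m b k j)) / b 0"
      using False assms(1) by (subst alpha.simps) simp
    then have "b 0 * alpha m b k n = alpha m b k (n - m) - (\<Sum>j<n. b (n - j) * alpha m b k j)"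
      using assms(2) by simp
    moreover have "(\<Sum>j\<le>n. b (n - j) * alpha m b k j) =
        (\<Sum>j<n. b (n - j) * alpha m b k j) + b 0 * alpha m b k n"
      by (simp flip: lessThan_Suc_atMost)
    ultimately show ?thesis using False unfolding l r by simp
  qed
qed

lemma quotient_continues_alpha:
  assumes "k < m" "b 0 \<noteq> 0" "conv_radius b > 0"
  shows "continues_alpha m b k
           (\<lambda>s. (\<Sum>n=k..<m. b (n - k) * s ^ n) / (gf b s - s ^ m))"
  unfolding continues_alpha_def
proof
  let ?q = "\<lambda>s. (\<Sum>n=k..<m. b (n - k) * s ^ n) / (gf b s - s ^ m)"
  have rad: "fps_conv_radius (Abs_fps b) = conv_radius b"
    by (simp add: fps_conv_radius_def)
  show "?q meromorphic_on eball 0 (conv_radius b)"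
    unfolding gf_eq_eval_fps
    by (intro meromorphic_on_divide analytic_on_imp_meromorphic_on analytic_intros)
      (auto simp: rad in_eball_iff)
  let ?B = "Abs_fps b - fps_X ^ m"
  have nz: "?B $ 0 \<noteq> 0" using assms by simp
  have "?q has_fps_expansion (\<Sum>n=k..<m. fps_const (b (n - k)) * fps_X ^ n) / ?B"
    unfolding gf_eq_eval_fps
    by (intro has_fps_expansion_divide' has_fps_expansion_sum has_fps_expansion_mult
          has_fps_expansion_const has_fps_expansion_fps_X_power has_fps_expansion_diff
          eval_fps_has_fps_expansion nz) (use assms rad in auto)
  moreover have "(\<Sum>n=k..<m. fps_const (b (n - k)) * fps_X ^ n) / ?B = Abs_fps (alpha m b k)"
  proof -
    have "?B \<noteq> 0" using nz by (metis fps_zero_nth)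
    then show ?thesis
      unfolding alpha_fps_identity[of k m b, OF assms(1,2), symmetric] by simp
  qed
  ultimately show "?q has_fps_expansion Abs_fps (alpha m b k)" by simp
qed

end

theory Submission
  imports Defs
begin

text \<open>
  With \<open>A\<close> the generating function of \<open>a\<close>, the recursion says that \<open>A(s) (B(s) - s\<^sup>m) = P(s)\<close>,
  where \<open>P(s) = (\<Sum>k<m. a\<^sub>k * (\<Sum>n=k..<m. b\<^sub>n\<^sub>-\<^sub>k s\<^sup>n))\<close> is a polynomial of degree below \<open>m\<close>.
  The identity theorem turns \<open>L\<^sub>j\<close> into \<open>P(\<lambda>\<^sub>j)\<close>.  As \<open>s\<close> tends to \<open>1\<close> from below,
  \<open>(1 - s) A(s)\<close> tends to \<open>lim a\<close>, and by Abel's theorem for \<open>B'\<close> the quotient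
  \<open>(B(s) - s\<^sup>m) / (1 - s)\<close> tends to \<open>m - (\<Sum>j. j b\<^sub>j)\<close>; hence \<open>P(1) = L\<close>.
  So the linear system prescribes \<open>P\<close> at \<open>m\<close> distinct points, which determines \<open>P\<close>, and the
  coefficients of \<open>P\<close> depend on \<open>a\<^sub>0, \<dots>, a\<^sub>m\<^sub>-\<^sub>1\<close> through a triangular matrix with
  diagonal entries \<open>b\<^sub>0 \<noteq> 0\<close>.
\<close>

subsection \<open>Abelian limits at the boundary point 1\<close>

lemma summable_bounded_power_series:
  fixes e :: "nat \<Rightarrow> 'a :: {real_normed_field, banach}"
  assumes "Bseq e" "norm z < 1"
  shows "summable (\<lambda>n. e n * z ^ n)"
proof -
  obtain K where K: "\<And>n. norm (e n) \<le> K"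
    using assms(1) by (auto simp: Bseq_def)
  show ?thesis
  proof (rule summable_comparison_test')
    show "summable (\<lambda>n. K * norm z ^ n)"
      using assms(2) by (intro summable_mult summable_geometric) simp
    show "norm (e n * z ^ n) \<le> K * norm z ^ n" for n
      by (simp add: norm_mult norm_power mult_right_mono K)
  qed
qed

text \<open>For 0 < x < 1 the weights \<open>(1 - x) * x ^ n\<close> are positive with sum 1, and as
  x tends to 1 each single weight tends to 0. The deviations \<open>e n - l\<close> with n < N thus
  contribute at most \<open>(1 - x) * C\<close>, and the small deviations from N on stay small on
  average.\<close>

lemma abel_mean_tendsto:
  fixes e :: "nat \<Rightarrow> 'a :: {real_normed_field, banach}"
  assumes "e \<longlonglongrightarrow> l"
  shows "((\<lambda>x. of_real (1 - x) * (\<Sum>n. e n * of_real x ^ n)) \<longlongrightarrow> l) (at_left (1 :: real))"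
proof (rule tendstoI)
  fix \<epsilon> :: real assume "\<epsilon> > 0"
  define d where "d = (\<lambda>n. e n - l)"
  have "d \<longlonglongrightarrow> 0"
    using assms by (simp add: d_def LIM_zero)
  then obtain N where N: "\<And>n. n \<ge> N \<Longrightarrow> norm (d n) < \<epsilon> / 2"
    using \<open>\<epsilon> > 0\<close> LIMSEQ_D[of d 0 "\<epsilon> / 2"] by auto
  define C where "C = (\<Sum>n<N. norm (d n))"
  have bound: "dist (of_real (1 - x) * (\<Sum>n. e n * of_real x ^ n)) l \<le> (1 - x) * C + \<epsilon> / 2"
    if x: "0 < x" "x < 1" for x
  proof -
    have d: "summable (\<lambda>n. d n * of_real x ^ n)"
      using \<open>d \<longlonglongrightarrow> 0\<close> x by (intro summable_bounded_power_series convergent_imp_Bseq)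
        (auto simp: convergent_def)
    have geo: "(\<lambda>n. of_real x ^ n :: 'a) sums (1 / (1 - of_real x))"
      using x by (intro geometric_sums) simp
    have "(\<lambda>n. d n * of_real x ^ n + l * of_real x ^ n) sums
        ((\<Sum>n. d n * of_real x ^ n) + l * (1 / (1 - of_real x)))"
      by (intro sums_add sums_mult geo summable_sums d)
    then have e: "(\<Sum>n. e n * of_real x ^ n) =
        (\<Sum>n. d n * of_real x ^ n) + l * (1 / (1 - of_real x))"
      by (simp add: d_def algebra_simps sums_iff)
    have nz: "(1 :: 'a) - of_real x \<noteq> 0"
      using x by (metis eq_iff_diff_eq_0 of_real_eq_1_iff order_less_irrefl)
    have "of_real (1 - x) * (\<Sum>n. e n * of_real x ^ n) - l =
        of_real (1 - x) * (\<Sum>n. d n * of_real x ^ n)"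
      unfolding e using nz by (simp add: field_simps)
    then have "dist (of_real (1 - x) * (\<Sum>n. e n * of_real x ^ n)) l =
        (1 - x) * norm (\<Sum>n. d n * of_real x ^ n)"
      using x by (simp add: dist_norm norm_mult del: of_real_diff)
    also have "\<dots> \<le> (1 - x) * (C + \<epsilon> / 2 * (1 / (1 - x)))"
    proof (rule mult_left_mono)
      \<comment> \<open>The majorant takes the full \<open>norm (d n)\<close> for n < N, where
        \<open>x ^ n\<close> is at most 1, and a geometric series everywhere, which covers the tail.
        Its sum is explicit.\<close>
      define g where "g = (\<lambda>n. (if n \<in> {..<N} then norm (d n) else 0) + \<epsilon> / 2 * x ^ n)"
      have "g sums (C + \<epsilon> / 2 * (1 / (1 - x)))"
        unfolding g_def C_def using x
        by (intro sums_add sums_If_finite_set sums_mult geometric_sums) auto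
      moreover have "norm (d n * of_real x ^ n) \<le> g n" for n
      proof (cases "n < N")
        case True
        have "norm (d n) * x ^ n \<le> norm (d n) * 1"
          using x by (intro mult_left_mono power_le_one) auto
        moreover have "0 \<le> \<epsilon> / 2 * x ^ n"
          using x \<open>\<epsilon> > 0\<close> by simp
        ultimately show ?thesis
          using True x unfolding g_def by (simp add: norm_mult norm_power)
      next
        case False
        then have "norm (d n) * x ^ n \<le> \<epsilon> / 2 * x ^ n"
          using x N[of n] by (intro mult_right_mono) auto
        then show ?thesis
          using False x unfolding g_def by (simp add: norm_mult norm_power)
      qed
      ultimately show "norm (\<Sum>n. d n * of_real x ^ n) \<le> C + \<epsilon> / 2 * (1 / (1 - x))"
        using norm_suminf_le[of "\<lambda>n. d n * of_real x ^ n" g] by (simp add: sums_iff)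
    qed (use x in simp)
    also have "\<dots> = (1 - x) * C + \<epsilon> / 2"
      using x by (simp add: field_simps)
    finally show ?thesis .
  qed
  have "((\<lambda>x. (1 - x) * C) \<longlongrightarrow> (1 - 1) * C) (at_left (1 :: real))"
    by (intro tendsto_intros)
  then have "\<forall>\<^sub>F x in at_left 1. (1 - x) * C < \<epsilon> / 2"
    using \<open>\<epsilon> > 0\<close> by (intro order_tendstoD(2)) auto
  moreover have "\<forall>\<^sub>F x :: real in at_left 1. 0 < x \<and> x < 1"
    using eventually_at_left_real[of 0 1] by simp
  ultimately show "\<forall>\<^sub>F x in at_left 1.
      dist (of_real (1 - x) * (\<Sum>n. e n * of_real x ^ n)) l < \<epsilon>"
    by eventually_elim (use bound in fastforce)
qed

text \<open>Summation by parts: the power series of \<open>c\<close> is \<open>1 - x\<close> times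
  the power series of its partial sums, so Abel's theorem reduces to the weighted means
  above.\<close>

theorem abel_limit:
  fixes c :: "nat \<Rightarrow> 'a :: {real_normed_field, banach}"
  assumes "c sums S"
  shows "((\<lambda>x. \<Sum>n. c n * of_real x ^ n) \<longlongrightarrow> S) (at_left (1 :: real))"
proof -
  define e where "e = (\<lambda>n. \<Sum>k\<le>n. c k)"
  have e: "e \<longlonglongrightarrow> S"
    using assms by (simp add: e_def sums_def_le)
  have eq: "of_real (1 - x) * (\<Sum>n. e n * of_real x ^ n) = (\<Sum>n. c n * of_real x ^ n)"
    if x: "0 < x" "x < 1" for x
  proof -
    define F where "F = (\<lambda>n. e n * of_real x ^ n)"
    have F: "F sums suminf F"
      unfolding F_def using e x
      by (intro summable_sums summable_bounded_power_series convergent_imp_Bseq)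
        (auto simp: convergent_def)
    \<comment> \<open>Multiplying by x aligns the powers of consecutive terms, so the difference
      leaves only \<open>e (Suc n) - e n = c (Suc n)\<close>. The term \<open>c 0\<close> is put
      back by \<open>sums_Suc\<close>.\<close>
    then have "(\<lambda>n. F (Suc n) - of_real x * F n) sums (suminf F - F 0 - of_real x * suminf F)"
      by (intro sums_diff sums_mult) (simp_all add: sums_Suc_iff)
    also have "(\<lambda>n. F (Suc n) - of_real x * F n) = (\<lambda>n. c (Suc n) * of_real x ^ Suc n)"
      by (simp add: F_def e_def algebra_simps)
    finally have "(\<lambda>n. c n * of_real x ^ n) sums
        (suminf F - F 0 - of_real x * suminf F + c 0 * of_real x ^ 0)"
      by (rule sums_Suc)
    then show ?thesis
      by (simp add: sums_iff F_def e_def algebra_simps)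
  qed
  have "\<forall>\<^sub>F x :: real in at_left 1. 0 < x \<and> x < 1"
    using eventually_at_left_real[of 0 1] by simp
  then have "\<forall>\<^sub>F x in at_left 1.
      of_real (1 - x) * (\<Sum>n. e n * of_real x ^ n) = (\<Sum>n. c n * of_real x ^ n)"
    by eventually_elim (use eq in blast)
  then show ?thesis
    by (rule Lim_transform_eventually[OF abel_mean_tendsto[OF e]])
qed

text \<open>A limit of the derivative at an endpoint is a one-sided derivative there. Since the
  values are vectors, the argument rests on the mean value inequality in place of the mean value
  equation.\<close>

lemma left_difference_quotient_tendsto:
  fixes f f' :: "real \<Rightarrow> 'a :: real_inner"
  assumes "a < b"
    and cont: "(f \<longlongrightarrow> f b) (at_left b)"
    and deriv: "\<And>t. a < t \<Longrightarrow> t < b \<Longrightarrow> (f has_vector_derivative f' t) (at t)"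
    and lim: "(f' \<longlongrightarrow> L) (at_left b)"
  shows "((\<lambda>t. (f b - f t) /\<^sub>R (b - t)) \<longlongrightarrow> L) (at_left b)"
proof (rule tendstoI)
  fix \<epsilon> :: real assume "\<epsilon> > 0"
  with lim have "\<forall>\<^sub>F t in at_left b. dist (f' t) L < \<epsilon>"
    by (rule tendstoD)
  then obtain c where c: "c < b" "\<And>t. c < t \<Longrightarrow> t < b \<Longrightarrow> dist (f' t) L < \<epsilon>"
    using eventually_at_left[OF \<open>a < b\<close>] by metis
  have "dist ((f b - f t) /\<^sub>R (b - t)) L < \<epsilon>" if t: "max a c < t" "t < b" for t
  proof -
    \<comment> \<open>Subtracting the linear function makes the derivative \<open>f' u - L\<close>,
      which has norm below \<open>\<epsilon>\<close> on the interval; the increment of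
      \<open>g\<close> is then the error to be bounded.\<close>
    define g where "g = (\<lambda>u. f u - u *\<^sub>R L)"
    have "continuous_on {t..b} f"
      unfolding continuous_on_eq_continuous_within
    proof
      fix u assume u: "u \<in> {t..b}"
      show "continuous (at u within {t..b}) f"
      proof (cases "u = b")
        case True
        then show ?thesis
          using cont t by (simp add: continuous_within at_within_Icc_at_left)
      next
        case False
        then have "(f has_vector_derivative f' u) (at u within {t..b})"
          using u t by (intro has_vector_derivative_at_within[OF deriv]) auto
        then show ?thesis
          by (rule has_vector_derivative_continuous)
      qed
    qed
    then have "continuous_on {t..b} g"
      unfolding g_def by (intro continuous_intros)
    moreover have "(g has_derivative (\<lambda>h. h *\<^sub>R (f' u - L))) (at u)" if "t < u" "u < b" for u
    proof -
      have "(g has_vector_derivative f' u - 1 *\<^sub>R L) (at u)"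
        unfolding g_def using that t
        by (auto intro!: derivative_eq_intros deriv simp: has_vector_derivative_def[of "\<lambda>u. u *\<^sub>R L"])
      then show ?thesis
        by (simp add: has_vector_derivative_def)
    qed
    ultimately obtain u where u: "u \<in> {t<..<b}"
      "norm (g b - g t) \<le> norm ((b - t) *\<^sub>R (f' u - L))"
      using mvt_general[of t b g "\<lambda>u h. h *\<^sub>R (f' u - L)"] t by blast
    have "g b - g t = (f b - f t) - (b - t) *\<^sub>R L"
      by (simp add: g_def algebra_simps)
    then have "(f b - f t) /\<^sub>R (b - t) - L = (g b - g t) /\<^sub>R (b - t)"
      using t by (simp add: scaleR_diff_right)
    then have "dist ((f b - f t) /\<^sub>R (b - t)) L = norm (g b - g t) / (b - t)"
      using t by (simp add: dist_norm divide_inverse)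
    also have "\<dots> \<le> norm ((b - t) *\<^sub>R (f' u - L)) / (b - t)"
      using u t by (intro divide_right_mono) auto
    also have "\<dots> = norm (f' u - L)"
      using t by simp
    also have "\<dots> < \<epsilon>"
      using c u t by (simp add: dist_norm)
    finally show ?thesis .
  qed
  then show "\<forall>\<^sub>F t in at_left b. dist ((f b - f t) /\<^sub>R (b - t)) L < \<epsilon>"
    using c \<open>a < b\<close> by (intro eventually_at_leftI[of "max a c"]) auto
qed

text \<open>The point 1 may lie on the circle of convergence, so it is approached along the reals
  only. Abel's theorem for \<open>b\<close> gives continuity up to 1, and Abel's theorem for
  \<open>diffs b\<close> gives the limit of the derivative.\<close>

lemma power_series_left_difference_quotient:
  fixes b :: "nat \<Rightarrow> complex"
  assumes "b sums S" "summable (\<lambda>j. of_nat j * b j)"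
  shows "((\<lambda>x. (S - gf b (of_real x)) / of_real (1 - x)) \<longlongrightarrow> (\<Sum>j. of_nat j * b j))
    (at_left (1 :: real))"
proof -
  define D where "D = (\<Sum>j. of_nat j * b j)"
  have "(\<lambda>j. of_nat j * b j) sums D"
    using assms(2) by (simp add: D_def summable_sums)
  \<comment> \<open>The term with index 0 vanishes, so the shift does not change the sum.\<close>
  then have "(\<lambda>j. of_nat (Suc j) * b (Suc j)) sums D"
    by (subst sums_Suc_iff) simp
  then have diffs: "diffs b sums D"
    by (simp add: diffs_def)
  define f where "f = (\<lambda>x :: real. gf b (of_real x))"
  have f1: "f 1 = S"
    using assms(1) by (simp add: f_def gf_def sums_iff)
  have "((\<lambda>t. (f 1 - f t) /\<^sub>R (1 - t)) \<longlongrightarrow> D) (at_left 1)"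
  proof (rule left_difference_quotient_tendsto)
    show "(f \<longlongrightarrow> f 1) (at_left 1)"
      unfolding f1 using abel_limit[OF assms(1)] by (simp add: f_def gf_def)
    show "((\<lambda>t. gf (diffs b) (of_real t)) \<longlongrightarrow> D) (at_left 1)"
      using abel_limit[OF diffs] by (simp add: gf_def)
    show "(f has_vector_derivative gf (diffs b) (of_real t)) (at t)" if "0 < t" "t < 1" for t
      unfolding f_def gf_def using assms(1) that
      by (intro has_vector_derivative_real_field termdiffs_strong[of _ 1]) (auto simp: sums_iff)
  qed simp
  then show ?thesis
    unfolding f1 by (simp add: D_def f_def scaleR_conv_of_real divide_inverse mult.commute)
qed

subsection \<open>The polynomial of the initial values\<close>

text \<open>This is the Cauchy product of \<open>b\<close> and \<open>x\<close> truncated below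
  degree m. Grouping by powers exposes the triangular dependence on \<open>x\<close>;
  \<open>poly_initial_poly\<close> recovers the double sum of the linear system.\<close>

definition initial_poly :: "nat \<Rightarrow> (nat \<Rightarrow> complex) \<Rightarrow> (nat \<Rightarrow> complex) \<Rightarrow> complex poly" where
  "initial_poly m b x = (\<Sum>n<m. monom (\<Sum>k\<le>n. b (n - k) * x k) n)"

lemma coeff_initial_poly:
  "poly.coeff (initial_poly m b x) n = (if n < m then \<Sum>k\<le>n. b (n - k) * x k else 0)"
  by (simp add: initial_poly_def coeff_sum)

lemma poly_initial_poly:
  "poly (initial_poly m b x) s = (\<Sum>k<m. (\<Sum>n=k..<m. b (n - k) * s ^ n) * x k)"
proof -
  have "poly (initial_poly m b x) s =
      (\<Sum>n\<in>{..<m}. \<Sum>k\<in>{k\<in>{..<m}. k \<le> n}. b (n - k) * s ^ n * x k)"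
    unfolding initial_poly_def poly_sum poly_monom sum_distrib_right
    by (intro sum.cong) (auto simp: mult_ac)
  also have "\<dots> = (\<Sum>k\<in>{..<m}. \<Sum>n\<in>{n\<in>{..<m}. k \<le> n}. b (n - k) * s ^ n * x k)"
    by (rule sum.swap_restrict) auto
  also have "\<dots> = (\<Sum>k<m. (\<Sum>n=k..<m. b (n - k) * s ^ n) * x k)"
    unfolding sum_distrib_right by (intro sum.cong) auto
  finally show ?thesis .
qed

lemma degree_initial_poly_less:
  assumes "m > 0"
  shows "degree (initial_poly m b x) < m"
proof -
  have "degree (initial_poly m b x) \<le> m - 1"
    using assms by (intro degree_le) (auto simp: coeff_initial_poly)
  with assms show ?thesis by simp
qed

text \<open>Forward substitution: the coefficient of degree k involves only \<open>x 0\<close>, ...,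
  \<open>x k\<close>, and \<open>x k\<close> enters with the factor \<open>b 0\<close>.\<close>

lemma initial_poly_inject:
  assumes "b 0 \<noteq> 0" "initial_poly m b x = initial_poly m b y" "k < m"
  shows "x k = y k"
  using \<open>k < m\<close>
proof (induction k rule: less_induct)
  case (less k)
  have "(\<Sum>i\<le>k. b (k - i) * x i) = (\<Sum>i\<le>k. b (k - i) * y i)"
    using arg_cong[OF assms(2), of "\<lambda>p. poly.coeff p k"] less.prems
    by (simp add: coeff_initial_poly)
  moreover have "(\<Sum>i<k. b (k - i) * x i) = (\<Sum>i<k. b (k - i) * y i)"
    using less by (intro sum.cong) auto
  ultimately show ?case
    using assms(1) by (simp flip: lessThan_Suc_atMost)
qed

text \<open>Below degree m the shifted series contributes nothing and the Cauchy product remains;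
  from degree m on, the recursion at index \<open>n - m\<close> makes the two terms cancel.\<close>

lemma recursion_fps_identity:
  assumes "\<And>n. a n = (\<Sum>j=0..n+m. b (n + m - j) * a j)"
  shows "(Abs_fps b - fps_X ^ m) * Abs_fps a = fps_of_poly (initial_poly m b a)"
proof (rule fps_ext)
  fix n
  have "fps_nth (Abs_fps b * Abs_fps a) n = (\<Sum>j=0..n. b (n - j) * a j)"
    by (subst mult.commute, subst fps_mult_nth) (simp add: mult.commute[of "b _"])
  moreover have "fps_nth (fps_X ^ m * Abs_fps a) n = (if n < m then 0 else a (n - m))"
    by (simp add: fps_X_power_mult_nth)
  moreover have "a (n - m) = (\<Sum>j=0..n. b (n - j) * a j)" if "\<not> n < m"
    using assms[of "n - m"] that by simp
  ultimately show "fps_nth ((Abs_fps b - fps_X ^ m) * Abs_fps a) n =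
      fps_nth (fps_of_poly (initial_poly m b a)) n"
    by (simp add: left_diff_distrib coeff_initial_poly atLeast0AtMost)
qed

lemma recursion_gf_identity:
  assumes "\<And>n. a n = (\<Sum>j=0..n+m. b (n + m - j) * a j)"
    and "norm z < conv_radius a" "norm z < conv_radius b"
  shows "(gf b z - z ^ m) * gf a z = poly (initial_poly m b a) z"
proof -
  have a: "norm z < fps_conv_radius (Abs_fps a)" and b: "norm z < fps_conv_radius (Abs_fps b)"
    using assms(2,3) by (simp_all add: fps_conv_radius_def)
  have "norm z < fps_conv_radius (Abs_fps b - fps_X ^ m)"
    using fps_conv_radius_diff[of "Abs_fps b" "fps_X ^ m"] b
    by (intro order_less_le_trans[OF b]) simp
  then have "eval_fps ((Abs_fps b - fps_X ^ m) * Abs_fps a) z =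
      (eval_fps (Abs_fps b) z - z ^ m) * eval_fps (Abs_fps a) z"
    using a b by (simp add: eval_fps_mult eval_fps_diff)
  then show ?thesis
    by (simp add: recursion_fps_identity[OF assms(1)] gf_eq_eval_fps)
qed

lemma initial_poly_at_1:
  assumes "b sums 1" "summable (\<lambda>j. of_nat j * b j)"
    and rec: "\<And>n. a n = (\<Sum>j=0..n+m. b (n + m - j) * a j)"
    and "convergent a"
  shows "poly (initial_poly m b a) 1 = (of_nat m - (\<Sum>j. of_nat j * b j)) * lim a"
proof -
  define P where "P = initial_poly m b a"
  define D where "D = (\<Sum>j. of_nat j * b j)"
  have radius_b: "conv_radius b \<ge> 1"
    using conv_radius_geI[of b 1] assms(1) by (simp add: sums_iff one_ereal_def)
  \<comment> \<open>A convergent sequence is bounded, so its power series converges at a real r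
    strictly between \<open>norm z\<close> and 1; the gap gives the strict inequality.\<close>
  have radius_a: "norm z < conv_radius a" if z: "norm z < 1" for z :: complex
  proof -
    obtain r where r: "norm z < r" "r < 1"
      using dense[OF z] by blast
    have "\<bar>r\<bar> < 1"
      using r norm_ge_zero[of z] by linarith
    then have "summable (\<lambda>n. a n * of_real r ^ n)"
      by (intro summable_bounded_power_series convergent_imp_Bseq assms(4)) auto
    from conv_radius_geI[OF this] have "ereal r \<le> conv_radius a"
      using r norm_ge_zero[of z] by simp
    moreover have "ereal (norm z) < ereal r"
      using r by simp
    ultimately show ?thesis
      by (rule order_less_le_trans[rotated])
  qed
  \<comment> \<open>The quotient \<open>(B(x) - x^m) / (1 - x)\<close> is split by inserting 1 into
    the numerator. Writing \<open>(1 - x^m) / (1 - x)\<close> as a finite geometric sum makes its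
    limit m immediate.\<close>
  have split: "(of_real (1 - x) * gf a (of_real x)) *
      ((\<Sum>i<m. of_real x ^ i) - (1 - gf b (of_real x)) / of_real (1 - x)) = poly P (of_real x)"
    if x: "0 < x" "x < 1" for x :: real
  proof -
    have nz: "1 - complex_of_real x \<noteq> 0"
      using x by (metis eq_iff_diff_eq_0 of_real_eq_1_iff order_less_irrefl)
    have nx: "norm (complex_of_real x) < 1"
      using x by simp
    then have nb: "norm (complex_of_real x) < conv_radius b"
      by (intro order_less_le_trans[OF _ radius_b]) (simp add: one_ereal_def)
    have clear: "c * g * (u - y / c) = (c * u - y) * g" if "c \<noteq> 0" for c g u y :: complex
      using that by (simp add: field_simps)
    have "(1 - complex_of_real x) * (\<Sum>i<m. of_real x ^ i) = 1 - of_real x ^ m"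
      by (simp add: one_diff_power_eq)
    then have "(of_real (1 - x) * gf a (of_real x)) *
      ((\<Sum>i<m. of_real x ^ i) - (1 - gf b (of_real x)) / of_real (1 - x)) =
        (gf b (of_real x) - of_real x ^ m) * gf a (of_real x)"
      using nz by (simp add: clear)
    also have "\<dots> = poly P (of_real x)"
      unfolding P_def by (rule recursion_gf_identity[OF rec radius_a[OF nx] nb])
    finally show ?thesis .
  qed
  have "a \<longlonglongrightarrow> lim a"
    using assms(4) by (simp add: convergent_LIMSEQ_iff)
  then have "((\<lambda>x. of_real (1 - x) * gf a (of_real x)) \<longlongrightarrow> lim a) (at_left 1)"
    unfolding gf_def by (rule abel_mean_tendsto)
  moreover have "((\<lambda>x. \<Sum>i<m. complex_of_real x ^ i) \<longlongrightarrow> (\<Sum>i<m. of_real 1 ^ i)) (at_left 1)"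
    by (intro tendsto_intros)
  ultimately have "((\<lambda>x. (of_real (1 - x) * gf a (of_real x)) *
      ((\<Sum>i<m. of_real x ^ i) - (1 - gf b (of_real x)) / of_real (1 - x)))
      \<longlongrightarrow> lim a * ((\<Sum>i<m. of_real 1 ^ i) - D)) (at_left 1)"
    unfolding D_def using power_series_left_difference_quotient[OF assms(1,2)]
    by (intro tendsto_mult tendsto_diff)
  moreover have "\<forall>\<^sub>F x :: real in at_left 1. 0 < x \<and> x < 1"
    using eventually_at_left_real[of 0 1] by simp
  then have "\<forall>\<^sub>F x in at_left 1. (of_real (1 - x) * gf a (of_real x)) *
      ((\<Sum>i<m. of_real x ^ i) - (1 - gf b (of_real x)) / of_real (1 - x)) = poly P (of_real x)"
    by eventually_elim (use split in blast)
  ultimately have "((\<lambda>x. poly P (of_real x)) \<longlongrightarrow> lim a * ((\<Sum>i<m. of_real 1 ^ i) - D)) (at_left 1)"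
    by (rule Lim_transform_eventually)
  moreover have "((\<lambda>x. poly P (of_real x)) \<longlongrightarrow> poly P (of_real 1)) (at_left 1)"
    by (intro tendsto_intros)
  ultimately have "lim a * ((\<Sum>i<m. of_real 1 ^ i) - D) = poly P (of_real 1)"
    by (rule tendsto_unique[OF trivial_limit_at_left_real])
  then show ?thesis
    by (simp add: P_def D_def mult.commute)
qed

subsection \<open>Limits at the simple roots\<close>

text \<open>All that is known of the chosen \<open>G_alpha\<close> is that it is meromorphic on the
  disk and has the right expansion at 0. The identity theorem carries the equation from 0 to z, up
  to isolated points, hence the punctured neighbourhood.\<close>

lemma G_alpha_identity:
  assumes "k < m" "b 0 \<noteq> 0" "conv_radius b > 0" "z \<in> eball 0 (conv_radius b)"
  shows "\<forall>\<^sub>F s in at z. (gf b s - s ^ m) * G_alpha m b k s = (\<Sum>n=k..<m. b (n - k) * s ^ n)"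
proof -
  define E where "E = eball (0 :: complex) (conv_radius b)"
  define H where "H = (\<lambda>s. (gf b s - s ^ m) * G_alpha m b k s - (\<Sum>n=k..<m. b (n - k) * s ^ n))"
  have radius: "fps_conv_radius (Abs_fps b) = conv_radius b"
    by (simp add: fps_conv_radius_def)
  have cont: "continues_alpha m b k (G_alpha m b k)"
    unfolding G_alpha_def
    using quotient_continues_alpha[OF assms(1-3)] by (rule someI[of "continues_alpha m b k"])
  have mero: "H meromorphic_on E"
  proof -
    have "(\<lambda>s. eval_fps (Abs_fps b) s - s ^ m) meromorphic_on E"
      unfolding E_def by (intro analytic_on_imp_meromorphic_on analytic_intros) (auto simp: radius)
    moreover have "G_alpha m b k meromorphic_on E"
      using cont by (simp add: continues_alpha_def E_def)
    moreover have "(\<lambda>s. \<Sum>n=k..<m. b (n - k) * s ^ n) meromorphic_on E"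
      by (intro analytic_on_imp_meromorphic_on analytic_intros)
    ultimately show ?thesis
      unfolding H_def gf_eq_eval_fps by (rule meromorphic_on_diff[OF meromorphic_on_mult])
  qed
  have "(\<lambda>s. eval_fps (Abs_fps b) s - s ^ m) has_fps_expansion (Abs_fps b - fps_X ^ m)"
    by (intro has_fps_expansion_diff has_fps_expansion_fps_X_power eval_fps_has_fps_expansion)
      (use assms radius in auto)
  moreover have "(\<lambda>s. \<Sum>n=k..<m. b (n - k) * s ^ n) has_fps_expansion
      (\<Sum>n=k..<m. fps_const (b (n - k)) * fps_X ^ n)"
    by (intro has_fps_expansion_sum has_fps_expansion_mult has_fps_expansion_const
          has_fps_expansion_fps_X_power)
  ultimately have "H has_fps_expansion ((Abs_fps b - fps_X ^ m) * Abs_fps (alpha m b k) -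
      (\<Sum>n=k..<m. fps_const (b (n - k)) * fps_X ^ n))"
    unfolding H_def gf_eq_eval_fps using cont
    by (intro has_fps_expansion_diff[OF has_fps_expansion_mult]) (auto simp: continues_alpha_def)
  then have "H has_fps_expansion 0"
    by (simp add: alpha_fps_identity[of k m b, OF assms(1,2)])
  then have "\<forall>\<^sub>F s in nhds 0. eval_fps 0 s = H s"
    by (simp only: has_fps_expansion_def)
  then have "\<forall>\<^sub>F s in nhds 0. H s = 0"
    by eventually_elim simp
  then have "\<forall>\<^sub>F s in at 0. H s = 0"
    unfolding eventually_at_filter by (rule eventually_mono) simp
  \<comment> \<open>\<open>H\<close> may take arbitrary values at isolated points;
    \<open>remove_sings\<close> normalises these and changes nothing on small punctured
    neighbourhoods.\<close>
  have sings: "\<forall>\<^sub>F s in at w. remove_sings H s = H s" if "w \<in> E" for w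
    using mero that by (intro eventually_remove_sings_eq_at meromorphic_on_isolated_singularity)
      (auto intro: meromorphic_on_subset)
  have "0 \<in> E"
    using assms by (simp add: E_def zero_ereal_def)
  from \<open>\<forall>\<^sub>F s in at 0. H s = 0\<close> sings[OF this]
  have "\<forall>\<^sub>F s in at 0. remove_sings H s = 0"
    by eventually_elim simp
  then have "\<exists>\<^sub>F s in at 0. remove_sings H s = 0"
    by (intro eventually_frequently) auto
  \<comment> \<open>The identity theorem on the open connected disk \<open>E\<close>: vanishing at
    points accumulating at 0 forces vanishing throughout.\<close>
  then have zero: "remove_sings H w = 0" if "w \<in> E" for w
    by (rule frequently_eq_meromorphic_imp_constant[OF _ remove_sings_nicely_meromorphic[OF mero]])
      (use \<open>0 \<in> E\<close> that in \<open>auto simp: E_def simp del: in_eball_iff\<close>)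
  have "z \<in> E"
    using assms by (simp add: E_def)
  then have "\<forall>\<^sub>F s in at z. s \<in> E"
    by (intro eventually_at_in_open') (simp_all add: E_def del: in_eball_iff)
  with sings[OF \<open>z \<in> E\<close>] show ?thesis
    by eventually_elim (use zero in \<open>auto simp: H_def\<close>)
qed

text \<open>The difference quotient at the root tends to the nonzero derivative, so it is eventually
  nonzero, and so is its numerator.\<close>

lemma simple_root_eventually_nonzero:
  assumes "simple_root f z" "f analytic_on {z}"
  shows "\<forall>\<^sub>F s in at z. f s \<noteq> 0"
proof -
  have "(f has_field_derivative deriv f z) (at z)"
    using analytic_on_imp_differentiable_at[OF assms(2)] by (simp add: DERIV_deriv_iff_field_differentiable)
  then have "((\<lambda>s. (f s - f z) / (s - z)) \<longlongrightarrow> deriv f z) (at z)"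
    by (simp add: has_field_derivative_iff)
  then have "\<forall>\<^sub>F s in at z. (f s - f z) / (s - z) \<noteq> 0"
    using assms(1) by (intro tendsto_imp_eventually_ne) (auto simp: simple_root_def)
  then show ?thesis
    by eventually_elim (use assms(1) in \<open>auto simp: simple_root_def\<close>)
qed

text \<open>Away from 1 the factors \<open>1 - s\<close> cancel, and \<open>G_alpha_identity\<close>
  turns each remaining product into a polynomial. Thus \<open>root_fun\<close> agrees near z with
  the continuous function \<open>poly (initial_poly m b a)\<close>.\<close>

lemma root_fun_tendsto:
  assumes "b 0 \<noteq> 0" "conv_radius b > 0" "z \<in> eball 0 (conv_radius b)" "z \<noteq> 1"
    and root: "simple_root (\<lambda>s. gf b s - s ^ m) z"
  shows "(root_fun m b a \<longlongrightarrow> poly (initial_poly m b a) z) (at z)"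
proof -
  have "(\<lambda>s. gf b s - s ^ m) analytic_on {z}"
    unfolding gf_eq_eval_fps using assms by (intro analytic_intros) (auto simp: fps_conv_radius_def)
  note simple_root_eventually_nonzero[OF root this]
  moreover have "\<forall>\<^sub>F s in at z. s \<noteq> 1"
    using assms(4) by (intro tendsto_imp_eventually_ne[OF tendsto_ident_at])
  moreover have "\<forall>\<^sub>F s in at z. \<forall>k\<in>{..<m}.
      (gf b s - s ^ m) * G_alpha m b k s = (\<Sum>n=k..<m. b (n - k) * s ^ n)"
    using G_alpha_identity assms by (intro eventually_ball_finite) auto
  ultimately have "\<forall>\<^sub>F s in at z. poly (initial_poly m b a) s = root_fun m b a s"
  proof eventually_elim
    case (elim s)
    have "root_fun m b a s = (\<Sum>k<m. (gf b s - s ^ m) * G_alpha m b k s * a k)"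
      using elim(2) by (simp add: root_fun_def M_def sum_distrib_left mult_ac)
    also have "\<dots> = poly (initial_poly m b a) s"
      unfolding poly_initial_poly using elim(3) by (intro sum.cong) auto
    finally show ?case ..
  qed
  moreover have "(poly (initial_poly m b a) \<longlongrightarrow> poly (initial_poly m b a) z) (at z)"
    using poly_isCont isCont_def by blast
  ultimately show ?thesis
    by (rule Lim_transform_eventually[rotated])
qed

section \<open>The linear system and the uniqueness of its solution\<close>

theorem theorem3:
  fixes m :: nat and a b lam :: "nat \<Rightarrow> complex"
  assumes "m \<ge> 2"
    and "b 0 \<noteq> 0"
    and "b sums 1"
    and "summable (\<lambda>j. of_nat j * b j)"
    and "of_nat m \<noteq> (\<Sum>j. of_nat j * b j)"
    and "inj_on lam {1..m-1}"
    and "\<And>j. j \<in> {1..m-1} \<Longrightarrow> lam j \<in> eball 0 (conv_radius b)"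
    and "\<And>j. j \<in> {1..m-1} \<Longrightarrow> simple_root (\<lambda>s. gf b s - s ^ m) (lam j)"
    and "\<And>j. j \<in> {1..m-1} \<Longrightarrow> lam j \<noteq> 1"
    and "\<And>n. a n = (\<Sum>j=0..n+m. b (n + m - j) * a j)"
    and "convergent a"
  shows "(\<forall>j\<in>{1..m-1}. (root_fun m b a \<longlongrightarrow> root_limit m b a (lam j)) (at (lam j)))
    \<and> (\<forall>j\<in>{1..m-1}.
        (\<Sum>k=0..m-1. (\<Sum>n=k..m-1. b (n - k) * lam j ^ n) * a k) = root_limit m b a (lam j))
    \<and> (\<Sum>k=0..m-1. (\<Sum>n=k..m-1. b (n - k)) * a k) = one_limit m b a
    \<and> (\<forall>x :: nat \<Rightarrow> complex.
        (\<forall>j\<in>{1..m-1}.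
          (\<Sum>k=0..m-1. (\<Sum>n=k..m-1. b (n - k) * lam j ^ n) * x k) = root_limit m b a (lam j))
        \<and> (\<Sum>k=0..m-1. (\<Sum>n=k..m-1. b (n - k)) * x k) = one_limit m b a
        \<longrightarrow> (\<forall>k\<in>{0..m-1}. x k = a k))"
proof -
  have set_m: "{0..m-1} = {..<m}"
    using \<open>m \<ge> 2\<close> by auto
  have poly_at: "(\<Sum>k=0..m-1. (\<Sum>n=k..m-1. b (n - k) * z ^ n) * x k) = poly (initial_poly m b x) z"
    for x z
  proof -
    have "{k..m-1} = {k..<m}" for k
      using \<open>m \<ge> 2\<close> by auto
    then show ?thesis
      unfolding poly_initial_poly set_m by simp
  qed
  from poly_at[of 1] have poly_at_1:
    "(\<Sum>k=0..m-1. (\<Sum>n=k..m-1. b (n - k)) * x k) = poly (initial_poly m b x) 1" for x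
    by simp
  have radius: "conv_radius b > 0"
  proof -
    have "conv_radius b \<ge> 1"
      using conv_radius_geI[of b 1] assms(3) by (simp add: sums_iff one_ereal_def)
    then show ?thesis
      by (rule less_le_trans[rotated]) simp
  qed
  have lim: "(root_fun m b a \<longlongrightarrow> poly (initial_poly m b a) (lam j)) (at (lam j))"
    if "j \<in> {1..m-1}" for j
    using that assms(2,7,8,9) radius by (intro root_fun_tendsto) auto
  have at_root: "root_limit m b a (lam j) = poly (initial_poly m b a) (lam j)"
    if "j \<in> {1..m-1}" for j
    unfolding root_limit_def using lim[OF that] by (intro tendsto_Lim) auto
  have at_1: "one_limit m b a = poly (initial_poly m b a) 1"
    unfolding one_limit_def using initial_poly_at_1[OF assms(3,4,10,11)] by simp
  have "x k = a k"
    if x: "\<forall>j\<in>{1..m-1}. poly (initial_poly m b x) (lam j) = poly (initial_poly m b a) (lam j)"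
      "poly (initial_poly m b x) 1 = poly (initial_poly m b a) 1" and "k < m" for x k
  proof -
    \<comment> \<open>The roots are distinct and differ from 1, so these are m interpolation nodes;
      two polynomials of degree below m that agree on them are equal.\<close>
    define A where "A = insert 1 (lam ` {1..m-1})"
    have "1 \<notin> lam ` {1..m-1}"
      using assms(9) by force
    then have "card A = m"
      using \<open>m \<ge> 2\<close> card_image[OF assms(6)] by (simp add: A_def)
    then have "initial_poly m b x = initial_poly m b a"
      using x degree_initial_poly_less[of m b] \<open>m \<ge> 2\<close>
      by (intro poly_eqI_degree[of A]) (auto simp: A_def)
    with \<open>b 0 \<noteq> 0\<close> show ?thesis
      using \<open>k < m\<close> by (rule initial_poly_inject)
  qed
  then show ?thesis
    unfolding poly_at poly_at_1 at_1 unfolding set_m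
    using lim at_root by (simp del: One_nat_def)
qed

end
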